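(* Let $\mathbb{F}_q$ be a finite field of odd characteristic with $q>5$ elements, let $k$ be an integer with $1\le k\le q-3$, let $a,b\in\mathbb{F}_q$, and let $h(x)\in\mathbb{F}_q[x]$ be a polynomial of degree at most $k-1$. The polynomial $f(x)=x^{k+2}-ax^{k+1}-bx^k+h(x)$ does not define a deep hole of the extended Reed-Solomon code $GRS_k(\mathbb{F}_q,\mathbb{F}_q)$ if and only if there exist a subset $S\subseteq\mathbb{F}_q$ of cardinality $k+1$ and an element $\gamma\in\mathbb{F}_q$ such that $$a=\gamma+\sum_{\beta\in S}\beta\quad\text{and}\quad b=-\sum_{\{\beta_1,\beta_2\}\subset S}\beta_1\beta_2-\gamma\sum_{\beta\in S}\beta,$$ where the sum over $\{\beta_1,\beta_2\}\subset S$ runs over all two-element subsets of $S$.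
   Context: Enumerate $\mathbb{F}_q=\{x_1,\dots,x_n\}$ with $n=q$. The extended Reed-Solomon code is $GRS_k(\mathbb{F}_q,\mathbb{F}_q)=\{(g(x_1),\dots,g(x_n))\in\mathbb{F}_q^n : g\in\mathbb{F}_q[x],\ \deg g\le k-1\}$ (the zero polynomial is allowed). For $f\in\mathbb{F}_q[x]$, the word defined by $f$ is $u_f=(f(x_1),\dots,f(x_n))$. The Hamming distance is $d(v,w)=\#\{i: v_i\ne w_i\}$ and the error distance is $d(v,C)=\min\{d(v,w): w\in C\}$. The polynomial $f$ is said to define a deep hole of $C=GRS_k(\mathbb{F}_q,\mathbb{F}_q)$ if $d(u_f,C)=n-k=q-k$. *)

theory Defs
  imports "HOL-Computational_Algebra.Computational_Algebra" "HOL-Library.Cardinality"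
begin

text \<open>A word is the list of its coordinates, and \<open>xs\<close> lists the evaluation points.\<close>

definition poly_word :: "'a::comm_semiring_0 list \<Rightarrow> 'a poly \<Rightarrow> 'a list" where
  "poly_word xs f = map (poly f) xs"

text \<open>The disjunct \<open>g = 0\<close> reflects the convention \<open>deg 0 = -\<infinity>\<close>; it matters only for \<open>k = 0\<close>.\<close>

definition GRS :: "nat \<Rightarrow> 'a::comm_semiring_0 list \<Rightarrow> 'a list set" where
  "GRS k xs = {poly_word xs g | g. g = 0 \<or> degree g < k}"

text \<open>Only meant for words of equal length.\<close>

definition hamming_dist :: "'a list \<Rightarrow> 'a list \<Rightarrow> nat" where
  "hamming_dist v w = card {i. i < length v \<and> v ! i \<noteq> w ! i}"

definition error_dist :: "'a list \<Rightarrow> 'a list set \<Rightarrow> nat" where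
  "error_dist v C = Min {hamming_dist v w | w. w \<in> C}"

text \<open>The subtraction is on natural numbers, so this is meaningful for \<open>k \<le> length xs\<close>.\<close>

definition defines_deep_hole :: "nat \<Rightarrow> 'a::comm_semiring_0 list \<Rightarrow> 'a poly \<Rightarrow> bool" where
  "defines_deep_hole k xs f \<longleftrightarrow> error_dist (poly_word xs f) (GRS k xs) = length xs - k"

end

theory Submission
  imports Defs
begin

text \<open>
  A codeword \<open>u\<^sub>g\<close> agreeing with \<open>u\<^sub>f\<close> on the \<open>k\<close> points of a set \<open>S\<close> always exists: reduce \<open>f\<close> modulo
  \<open>\<Prod>\<beta>\<in>S. x - \<beta>\<close>. So the error distance is at most \<open>n - k\<close>, and \<open>f\<close> fails to define a deep hole iff some
  \<open>g\<close> of degree less than \<open>k\<close> agrees with \<open>f\<close> on \<open>k + 1\<close> points \<open>S\<close>, that is, iff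
  \<open>f - g = (x - \<gamma>) * (\<Prod>\<beta>\<in>S. x - \<beta>)\<close> for some \<open>\<gamma>\<close>. As \<open>g\<close> is arbitrary below degree \<open>k\<close>, this only
  constrains the coefficients of \<open>x\<^bsup>k+1\<^esup>\<close> and \<open>x\<^bsup>k\<^esup>\<close>, which Vieta's formulas compute.
\<close>

definition root_poly :: "'a::comm_ring_1 set \<Rightarrow> 'a poly" where
  "root_poly S = (\<Prod>\<beta>\<in>S. [:- \<beta>, 1:])"

lemma poly_root_poly:
  assumes "finite S" "x \<in> S"
  shows "poly (root_poly S) x = 0"
  unfolding root_poly_def poly_prod by (rule prod_zero) (use assms in auto)

lemma degree_root_poly: "degree (root_poly (S :: 'a::idom set)) = card S"
  unfolding root_poly_def by (subst degree_prod_eq_sum_degree) auto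

lemma lead_coeff_root_poly: "coeff (root_poly (S :: 'a::idom set)) (card S) = 1"
proof -
  have "lead_coeff (root_poly S) = 1"
    unfolding root_poly_def lead_coeff_prod by simp
  then show ?thesis by (simp add: degree_root_poly)
qed

lemma root_poly_nonzero: "root_poly (S :: 'a::idom set) \<noteq> 0"
  using lead_coeff_root_poly[of S] by auto

text \<open>Vieta's formula. Expanding the product, a subset \<open>T\<close> of \<open>S\<close>
  records the factors that contribute \<open>- \<beta>\<close>, while the others contribute
  \<open>x\<close>. Stating the size as \<open>n + m = card S\<close> avoids a truncated
  subtraction.\<close>

lemma coeff_root_poly:
  fixes S :: "'a::comm_ring_1 set"
  assumes "finite S" "n + m = card S"
  shows "coeff (root_poly S) n = (- 1) ^ m * (\<Sum>T | T \<subseteq> S \<and> card T = m. \<Prod>\<beta>\<in>T. \<beta>)"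
proof -
  have "root_poly S = (\<Prod>\<beta>\<in>S. [:- \<beta>:] + [:0, 1:])"
    by (simp add: root_poly_def)
  also have "\<dots> = (\<Sum>T\<in>Pow S. (\<Prod>\<beta>\<in>T. [:- \<beta>:]) * (\<Prod>\<beta>\<in>S - T. [:0, 1:]))"
    by (rule prod_add) (rule assms(1))
  also have "\<dots> = (\<Sum>T\<in>Pow S. monom (\<Prod>\<beta>\<in>T. - \<beta>) (card S - card T))"
  proof (rule sum.cong[OF refl])
    fix T assume "T \<in> Pow S"
    then have "finite T" "T \<subseteq> S" using assms(1) finite_subset by auto
    have "(\<Prod>\<beta>\<in>T. [:- \<beta>:]) = [:\<Prod>\<beta>\<in>T. - \<beta>:]"
      using \<open>finite T\<close> by induction auto
    moreover have "(\<Prod>\<beta>\<in>S - T. [:0, 1:]) = (monom 1 (card S - card T) :: 'a poly)"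
      using \<open>finite T\<close> \<open>T \<subseteq> S\<close> by (simp add: card_Diff_subset monom_altdef)
    ultimately show "(\<Prod>\<beta>\<in>T. [:- \<beta>:]) * (\<Prod>\<beta>\<in>S - T. [:0, 1:]) =
        monom (\<Prod>\<beta>\<in>T. - \<beta>) (card S - card T)"
      by (simp add: smult_monom)
  qed
  finally have "coeff (root_poly S) n =
      (\<Sum>T\<in>Pow S. if card S - card T = n then \<Prod>\<beta>\<in>T. - \<beta> else 0)"
    by (simp add: coeff_sum)
  also have "\<dots> = (\<Sum>T\<in>Pow S. if card T = m then (- 1) ^ m * (\<Prod>\<beta>\<in>T. \<beta>) else 0)"
  proof (rule sum.cong[OF refl])
    fix T assume "T \<in> Pow S"
    \<comment> \<open>This bound makes the exponent \<open>card S - card T\<close> an exact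
      difference, so that it equals \<open>n\<close> precisely for the subsets of size
      \<open>m\<close>.\<close>
    then have "card T \<le> card S" using assms(1) by (simp add: card_mono)
    then have "card S - card T = n \<longleftrightarrow> card T = m" using assms(2) by auto
    then show "(if card S - card T = n then \<Prod>\<beta>\<in>T. - \<beta> else 0) =
        (if card T = m then (- 1) ^ m * (\<Prod>\<beta>\<in>T. \<beta>) else 0)"
      by (simp add: prod_uminus)
  qed
  also have "\<dots> = (\<Sum>T | T \<subseteq> S \<and> card T = m. (- 1) ^ m * (\<Prod>\<beta>\<in>T. \<beta>))"
    using assms(1) by (subst sum.inter_filter[symmetric]) auto
  finally show ?thesis by (simp add: sum_distrib_left)
qed

lemma coeff_root_poly_1:
  fixes S :: "'a::comm_ring_1 set"
  assumes "finite S" "card S = Suc n"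
  shows "coeff (root_poly S) n = - (\<Sum>\<beta>\<in>S. \<beta>)"
proof -
  have "{T. T \<subseteq> S \<and> card T = 1} = (\<lambda>\<beta>. {\<beta>}) ` S"
    by (auto simp: card_1_singleton_iff)
  then show ?thesis
    using coeff_root_poly[of S n 1] assms by (simp add: sum.reindex)
qed

lemma poly_mod_root_poly:
  fixes p :: "'a::field poly"
  assumes "finite S" "x \<in> S"
  shows "poly (p mod root_poly S) x = poly p x"
proof -
  have "poly p x = poly (p div root_poly S * root_poly S + p mod root_poly S) x" by simp
  also have "\<dots> = poly (p mod root_poly S) x"
    unfolding poly_add poly_mult poly_root_poly[OF assms] by simp
  finally show ?thesis by simp
qed

text \<open>The remainder modulo \<open>root_poly S\<close> still vanishes on \<open>S\<close>. If
  it were nonzero, it would have at least \<open>card S\<close> roots but degree below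
  \<open>card S\<close>.\<close>

lemma root_poly_dvd:
  fixes p :: "'a::field poly"
  assumes "finite S" "\<And>x. x \<in> S \<Longrightarrow> poly p x = 0"
  shows "root_poly S dvd p"
proof (rule ccontr)
  let ?r = "p mod root_poly S"
  assume "\<not> root_poly S dvd p"
  then have nz: "?r \<noteq> 0" by (simp add: dvd_eq_mod_eq_0)
  have "poly ?r x = 0" if "x \<in> S" for x
    using assms that by (simp add: poly_mod_root_poly)
  then have "card S \<le> card {x. poly ?r x = 0}"
    using nz by (intro card_mono poly_roots_finite) auto
  also have "\<dots> \<le> degree ?r" by (rule card_poly_roots_bound[OF nz])
  also have "\<dots> < card S"
    using degree_mod_less[OF root_poly_nonzero, of p S] nz by (simp add: degree_root_poly)
  finally show False by simp
qed

lemma interpolation_exists: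
  fixes f :: "'a::field poly"
  assumes "finite S"
  obtains g where "g = 0 \<or> degree g < card S" "\<And>x. x \<in> S \<Longrightarrow> poly g x = poly f x"
proof
  show "f mod root_poly S = 0 \<or> degree (f mod root_poly S) < card S"
    using degree_mod_less[OF root_poly_nonzero, of f S] by (simp add: degree_root_poly)
  show "poly (f mod root_poly S) x = poly f x" if "x \<in> S" for x
    using assms that by (rule poly_mod_root_poly)
qed

text \<open>Since the evaluation points are distinct, positions correspond bijectively to points, so
  disagreements can be counted in the field instead of in the list.\<close>

lemma hamming_dist_poly_word:
  assumes "distinct xs"
  shows "hamming_dist (poly_word xs f) (poly_word xs g) =
    length xs - card {x \<in> set xs. poly f x = poly g x}"
proof -
  have "hamming_dist (poly_word xs f) (poly_word xs g) =
      card {i. i < length xs \<and> poly f (xs ! i) \<noteq> poly g (xs ! i)}"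
    unfolding hamming_dist_def poly_word_def by (rule arg_cong[where f = card]) auto
  also have "\<dots> = card ((!) xs ` {i. i < length xs \<and> poly f (xs ! i) \<noteq> poly g (xs ! i)})"
    by (rule card_image[symmetric]) (use assms in \<open>auto simp: inj_on_def nth_eq_iff_index_eq\<close>)
  also have "(!) xs ` {i. i < length xs \<and> poly f (xs ! i) \<noteq> poly g (xs ! i)} =
      set xs - {x \<in> set xs. poly f x = poly g x}"
    by (auto simp: in_set_conv_nth image_iff)
  also have "card \<dots> = length xs - card {x \<in> set xs. poly f x = poly g x}"
    using assms by (subst card_Diff_subset) (auto simp: distinct_card)
  finally show ?thesis .
qed

lemma not_deep_hole_iff:
  fixes f :: "'a::field poly"
  assumes "distinct xs" "k < length xs"
  shows "\<not> defines_deep_hole k xs f \<longleftrightarrow>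
    (\<exists>S g. S \<subseteq> set xs \<and> card S = k + 1 \<and> (g = 0 \<or> degree g < k) \<and>
      (\<forall>x\<in>S. poly f x = poly g x))"
proof -
  define agree where "agree g = {x \<in> set xs. poly f x = poly g x}" for g
  define D where "D = {hamming_dist (poly_word xs f) w | w. w \<in> GRS k xs}"
  have card_set: "card (set xs) = length xs" using assms(1) by (rule distinct_card)
  have D_eq: "D = {length xs - card (agree g) | g. g = 0 \<or> degree g < k}"
    unfolding D_def GRS_def agree_def hamming_dist_poly_word[OF assms(1), symmetric] by blast
  \<comment> \<open>The field may be infinite here, and with it the code. The distances are bounded
    by the word length, so \<open>Min D\<close> is still a genuine minimum.\<close>
  have fin: "finite D"
    by (rule finite_subset[of _ "{..length xs}"]) (auto simp: D_eq)
  \<comment> \<open>Interpolation at any \<open>k\<close> points bounds the error distance by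
    \<open>length xs - k\<close>, so failing to be a deep hole means strict inequality.\<close>
  obtain S0 where S0: "S0 \<subseteq> set xs" "card S0 = k"
    using obtain_subset_with_card_n[of k "set xs"] assms(2) card_set by auto
  then have "finite S0" using finite_subset by auto
  then obtain g0 where g0: "g0 = 0 \<or> degree g0 < k" "\<And>x. x \<in> S0 \<Longrightarrow> poly g0 x = poly f x"
    using interpolation_exists S0(2) by metis
  have "S0 \<subseteq> agree g0" using g0 S0 by (auto simp: agree_def)
  then have "k \<le> card (agree g0)"
    using card_mono[of "agree g0" S0] S0 by (auto simp: agree_def)
  moreover have g0D: "length xs - card (agree g0) \<in> D" using g0(1) by (auto simp: D_eq)
  ultimately have "Min D \<le> length xs - k"
    by (meson Min_le diff_le_mono2 fin le_trans)
  then have "\<not> defines_deep_hole k xs f \<longleftrightarrow> Min D < length xs - k"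
    by (auto simp: defines_deep_hole_def error_dist_def D_def)
  also have "\<dots> \<longleftrightarrow> (\<exists>g. (g = 0 \<or> degree g < k) \<and> length xs - card (agree g) < length xs - k)"
    using fin g0D by (subst Min_less_iff) (auto simp: D_eq)
  \<comment> \<open>From right to left this uses \<open>k < length xs\<close>: otherwise both
    natural-number differences would be 0.\<close>
  also have "\<dots> \<longleftrightarrow> (\<exists>g. (g = 0 \<or> degree g < k) \<and> k + 1 \<le> card (agree g))"
    using assms(2) by (intro ex_cong1 conj_cong) auto
  also have "\<dots> \<longleftrightarrow> (\<exists>g. (g = 0 \<or> degree g < k) \<and> (\<exists>S \<subseteq> agree g. card S = k + 1))"
  proof (intro ex_cong1 conj_cong refl)
    fix g
    have "finite (agree g)" by (auto simp: agree_def)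
    \<comment> \<open>The agreement set may be larger than \<open>k + 1\<close>; it is shrunk to
      exactly that size, which later forces the cofactor of \<open>root_poly S\<close> to be
      linear.\<close>
    then show "k + 1 \<le> card (agree g) \<longleftrightarrow> (\<exists>S \<subseteq> agree g. card S = k + 1)"
      by (metis card_mono obtain_subset_with_card_n)
  qed
  also have "\<dots> \<longleftrightarrow> (\<exists>S g. S \<subseteq> set xs \<and> card S = k + 1 \<and> (g = 0 \<or> degree g < k) \<and>
      (\<forall>x\<in>S. poly f x = poly g x))"
    unfolding agree_def by blast
  finally show ?thesis .
qed

lemma coeff_root_poly_times_linear:
  fixes S :: "'a::idom set" and \<gamma> :: 'a
  assumes "finite S" "card S = k + 1" "1 \<le> k"
  defines "p \<equiv> root_poly S * [:- \<gamma>, 1:]"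
  shows "degree p = k + 2" "coeff p (k + 2) = 1"
    "coeff p (k + 1) = - (\<gamma> + (\<Sum>\<beta>\<in>S. \<beta>))"
    "coeff p k = (\<Sum>T | T \<subseteq> S \<and> card T = 2. \<Prod>\<beta>\<in>T. \<beta>) + \<gamma> * (\<Sum>\<beta>\<in>S. \<beta>)"
proof -
  \<comment> \<open>Multiplying by \<open>x\<close> shifts indices, so \<open>coeff p k\<close>
    involves coefficient \<open>k - 1\<close> of \<open>root_poly S\<close>, the second elementary
    symmetric function.\<close>
  obtain j where j: "k = Suc j" using assms(3) by (cases k) auto
  have p: "p = smult (- \<gamma>) (root_poly S) + pCons 0 (root_poly S)"
    by (simp add: p_def)
  have c: "coeff (root_poly S) (Suc k) = 1" "coeff (root_poly S) k = - (\<Sum>\<beta>\<in>S. \<beta>)"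
    "coeff (root_poly S) j = (\<Sum>T | T \<subseteq> S \<and> card T = 2. \<Prod>\<beta>\<in>T. \<beta>)"
    "coeff (root_poly S) (Suc (Suc k)) = 0"
    using lead_coeff_root_poly[of S] coeff_root_poly_1[of S k] coeff_root_poly[of S j 2]
      assms(1,2) j by (auto intro!: coeff_eq_0 simp: degree_root_poly)
  show "degree p = k + 2"
    unfolding p_def by (subst degree_mult_eq) (use assms(2) in \<open>auto simp: degree_root_poly root_poly_nonzero\<close>)
  show "coeff p (k + 2) = 1" "coeff p (k + 1) = - (\<gamma> + (\<Sum>\<beta>\<in>S. \<beta>))"
    using c by (simp_all add: p)
  show "coeff p k = (\<Sum>T | T \<subseteq> S \<and> card T = 2. \<Prod>\<beta>\<in>T. \<beta>) + \<gamma> * (\<Sum>\<beta>\<in>S. \<beta>)"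
    using c j by (simp add: p)
qed

theorem lemma4p1:
  fixes xs :: "'a::{field, finite} list" and k :: nat and a b :: 'a and h :: "'a poly"
  assumes "odd CHAR('a)" and "CARD('a) > 5"
    and "distinct xs" and "set xs = UNIV"
    and "1 \<le> k" and "k \<le> CARD('a) - 3"
    and "degree h \<le> k - 1"
  shows "\<not> defines_deep_hole k xs (monom 1 (k + 2) - monom a (k + 1) - monom b k + h) \<longleftrightarrow>
    (\<exists>S \<gamma>. card S = k + 1 \<and>
       a = \<gamma> + (\<Sum>\<beta>\<in>S. \<beta>) \<and>
       b = - (\<Sum>T | T \<subseteq> S \<and> card T = 2. \<Prod>\<beta>\<in>T. \<beta>) - \<gamma> * (\<Sum>\<beta>\<in>S. \<beta>))"
    (is "\<not> defines_deep_hole k xs ?f \<longleftrightarrow> ?rhs")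
proof -
  have "length xs = CARD('a)" using assms(3,4) distinct_card by metis
  then have "k < length xs" using assms(2,6) by simp
  note iff = not_deep_hole_iff[OF assms(3) this, of ?f]
  \<comment> \<open>As \<open>1 \<le> k\<close>, the bound \<open>k - 1\<close> is not truncated and
    \<open>degree h < k\<close>: \<open>h\<close> does not touch the coefficients from
    \<open>k\<close> upwards.\<close>
  have h0: "coeff h i = 0" if "k \<le> i" for i
    using assms(5,7) that by (intro coeff_eq_0) auto
  have f_coeffs: "coeff ?f (k + 2) = 1" "coeff ?f (k + 1) = - a" "coeff ?f k = - b"
    by (simp_all add: h0)
  have f_high: "coeff ?f i = 0" if "i > k + 2" for i
    using that by (simp add: h0)
  show ?thesis
  proof
    assume "\<not> defines_deep_hole k xs ?f"
    then obtain S g where S: "card S = k + 1" and g: "g = 0 \<or> degree g < k"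
      and agree: "\<forall>x\<in>S. poly ?f x = poly g x"
      using iff by blast
    have g0: "coeff g i = 0" if "k \<le> i" for i
      using g that by (auto intro: coeff_eq_0)
    have fg: "coeff (?f - g) (k + 2) = 1" "coeff (?f - g) (k + 1) = - a" "coeff (?f - g) k = - b"
      using f_coeffs g0 by simp_all
    have deg: "degree (?f - g) = k + 2"
    proof (rule antisym)
      show "degree (?f - g) \<le> k + 2"
      proof (intro degree_le allI impI)
        fix i assume "k + 2 < i"
        then show "coeff (?f - g) i = 0"
          using f_high[of i] g0[of i] by (simp only: coeff_diff[of ?f g]) simp
      qed
      show "k + 2 \<le> degree (?f - g)"
        by (rule le_degree) (use fg in simp)
    qed
    have "root_poly S dvd ?f - g"
      by (rule root_poly_dvd) (use agree in auto)
    then obtain u where u: "?f - g = root_poly S * u" by (rule dvdE)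
    have "?f - g \<noteq> 0" using deg by force
    then have "u \<noteq> 0" using u by auto
    \<comment> \<open>Degrees add up to \<open>k + 2\<close>, of which \<open>root_poly S\<close>
      takes \<open>k + 1\<close>. Both the product and \<open>root_poly S\<close> are monic, hence
      so is \<open>u\<close>.\<close>
    then have "degree u = 1"
      using deg S unfolding u by (simp add: degree_mult_eq root_poly_nonzero degree_root_poly)
    moreover have "lead_coeff u = 1"
    proof -
      have "lead_coeff (root_poly S * u) = 1" using fg(1) deg unfolding u by simp
      then show ?thesis
        by (simp add: lead_coeff_mult degree_root_poly lead_coeff_root_poly)
    qed
    ultimately obtain c where "u = [:c, 1:]"
      by (cases u) (auto elim: degree_eq_zeroE split: if_splits)
    \<comment> \<open>The required \<gamma> is the root \<open>- c\<close> of the linear cofactor;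
      the equations follow by comparing coefficients \<open>k + 1\<close> and
      \<open>k\<close>.\<close>
    then have "?f - g = root_poly S * [:- (- c), 1:]" using u by simp
    then have "a = - c + (\<Sum>\<beta>\<in>S. \<beta>)"
      "b = - (\<Sum>T | T \<subseteq> S \<and> card T = 2. \<Prod>\<beta>\<in>T. \<beta>) - (- c) * (\<Sum>\<beta>\<in>S. \<beta>)"
      using fg(2,3) coeff_root_poly_times_linear(3,4)[OF finite S assms(5), of "- c"]
      by (simp_all add: minus_equation_iff[of b] eq_commute[of _ b] algebra_simps)
    with S show ?rhs by blast
  next
    assume ?rhs
    then obtain S \<gamma> where S: "card S = k + 1" and a: "a = \<gamma> + (\<Sum>\<beta>\<in>S. \<beta>)"
      and b: "b = - (\<Sum>T | T \<subseteq> S \<and> card T = 2. \<Prod>\<beta>\<in>T. \<beta>) - \<gamma> * (\<Sum>\<beta>\<in>S. \<beta>)"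
      by blast
    define p where "p = root_poly S * [:- \<gamma>, 1:]"
    note p = coeff_root_poly_times_linear[OF finite S assms(5), of \<gamma>, folded p_def]
    \<comment> \<open>The equations for \<open>a\<close> and \<open>b\<close> say that
      \<open>?f\<close> and \<open>p\<close> share the coefficients at \<open>k + 1\<close> and
      \<open>k\<close>. Both are monic of degree \<open>k + 2\<close>, so the difference has degree
      below \<open>k\<close>, and it agrees with \<open>?f\<close> wherever \<open>p\<close>
      vanishes, in particular on \<open>S\<close>.\<close>
    define g where "g = ?f - p"
    have g_high: "coeff g i = 0" if "k \<le> i" for i
    proof -
      consider "i = k" | "i = k + 1" | "i = k + 2" | "i > k + 2" using \<open>k \<le> i\<close> by linarith
      then have "coeff ?f i = coeff p i"
      proof cases
        case 4
        then show ?thesis using f_high p(1) by (simp only: coeff_eq_0)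
      qed (use p f_coeffs a b in auto)
      then show ?thesis unfolding g_def by simp
    qed
    have "degree g \<le> k - 1" by (rule degree_le) (use g_high in auto)
    then have "degree g < k" using assms(5) by simp
    moreover have "\<forall>x\<in>S. poly ?f x = poly g x"
      unfolding g_def by (simp add: p_def poly_root_poly)
    ultimately show "\<not> defines_deep_hole k xs ?f"
      using iff S assms(4) by blast
  qed
qed

end
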